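(* Let $f$ be a solution, of class $C^{1,2}([0,T)\times\mathbb{R})\cap C([0,T]\times\mathbb{R})$, of $$\begin{cases}f_t(t,y)+\frac12 f_{yy}(t,y)\frac{\gamma^2(t)}{\sigma^2}+f_y(t,y)\frac{\gamma(t)(r-y)}{\sigma^2}\\ \quad-\Big[\frac{(r-y+a\sqrt{\gamma(t)})^2}{2\sigma^2}I_{\{r-y+a\sqrt{\gamma(t)}\le0\}}+\frac{(r-y-a\sqrt{\gamma(t)})^2}{2\sigma^2}I_{\{r-y-a\sqrt{\gamma(t)}\ge0\}}\Big]=0,&(t,y)\in[0,T)\times\mathbb{R},\\ f(T,y)=0,&y\in\mathbb{R}.\end{cases}$$ Then $\varphi(t,x,y)=-\frac1k e^{-ke^{r(T-t)}x+f(t,y)}$ is a solution $V=\varphi$ of the HJBI equation $$\begin{cases}\sup\limits_{\pi\in\mathbb{R}}\Big\{V_t+\frac12V_{xx}\pi^2\sigma^2+\frac12V_{yy}\frac{\gamma^2(t)}{\sigma^2}+V_{xy}\pi\gamma(t)+V_xr(x-\pi)-V_y\frac{\gamma(t)}{\sigma^2}y+\inf\limits_{\mu\in\Lambda_{t,y}}\big\{\mu\big(V_x\pi+V_y\frac{\gamma(t)}{\sigma^2}\big)\big\}\Big\}=0,\\ V(T,x,y)=U(x).\end{cases}$$ Moreover, with $V=\varphi$, the supremum over $\pi$ is attained at $$\hat\pi(t,y)=\begin{cases}\frac{e^{-r(T-t)}}{k\sigma^2}\big[f_y(t,y)\gamma(t)+y-a\sqrt{\gamma(t)}-r\big],& r<\mu^{\min}_{t,y},\\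 \frac{e^{-r(T-t)}}{k\sigma^2}f_y(t,y)\gamma(t),& r\in\Lambda_{t,y},\\ \frac{e^{-r(T-t)}}{k\sigma^2}\big[f_y(t,y)\gamma(t)+y+a\sqrt{\gamma(t)}-r\big],& r>\mu^{\max}_{t,y},\end{cases}$$ and the worst-case scenario for $\mu$ (the value attaining the infimum over $\mu\in\Lambda_{t,y}$ at $\pi=\hat\pi(t,y)$) is $$\mu^*=\begin{cases}\mu^{\min}_{t,y},& r<\mu^{\min}_{t,y},\\ \text{any }\mu\in\Lambda_{t,y},& r\in\Lambda_{t,y},\\ \mu^{\max}_{t,y},& r>\mu^{\max}_{t,y}.\end{cases}$$
   Context: Constants: $T>0$, $\sigma>0$, $\sigma_0>0$, $k>0$, $a\ge0$, $r\in\mathbb{R}$. $\gamma(t)=(\sigma_0^{-2}+t\sigma^{-2})^{-1}$ for $t\in[0,T]$; $\mu^{\min}_{t,y}=y-a\sqrt{\gamma(t)}$, $\mu^{\max}_{t,y}=y+a\sqrt{\gamma(t)}$, $\Lambda_{t,y}=[\mu^{\min}_{t,y},\mu^{\max}_{t,y}]$. $U(x)=-\frac1ke^{-kx}$, $x\in\mathbb{R}$. The HJBI equation is required at all $(t,x,y)\in[0,T)\times\mathbb{R}\times\mathbb{R}$ and the terminal condition for all $(x,y)\in\mathbb{R}^2$. Subscripts on $V$, $\varphi$, $f$ denote partial derivatives; $I_{\{\cdot\}}$ is the indicator. *)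

theory Defs
  imports "HOL-Analysis.Analysis"
begin

definition gam :: "real \<Rightarrow> real \<Rightarrow> real \<Rightarrow> real" where
  "gam \<sigma> \<sigma>0 t = 1 / (1 / \<sigma>0\<^sup>2 + t / \<sigma>\<^sup>2)"

definition mu_min :: "real \<Rightarrow> real \<Rightarrow> real \<Rightarrow> real \<Rightarrow> real \<Rightarrow> real" where
  "mu_min \<sigma> \<sigma>0 a t y = y - a * sqrt (gam \<sigma> \<sigma>0 t)"

definition mu_max :: "real \<Rightarrow> real \<Rightarrow> real \<Rightarrow> real \<Rightarrow> real \<Rightarrow> real" where
  "mu_max \<sigma> \<sigma>0 a t y = y + a * sqrt (gam \<sigma> \<sigma>0 t)"

definition Lam :: "real \<Rightarrow> real \<Rightarrow> real \<Rightarrow> real \<Rightarrow> real \<Rightarrow> real set" where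
  "Lam \<sigma> \<sigma>0 a t y = {mu_min \<sigma> \<sigma>0 a t y .. mu_max \<sigma> \<sigma>0 a t y}"

definition U :: "real \<Rightarrow> real \<Rightarrow> real" where
  "U k x = - (1 / k) * exp (- k * x)"

text \<open>
  Functions of time and space are total; only their values for times in \<open>{0..T}\<close> matter.
  Time derivatives are taken within \<open>{0..<T}\<close>, hence are right derivatives at time 0.
  As usual, \<open>V\<^sub>x\<^sub>y = (V\<^sub>x)\<^sub>y\<close>.
\<close>

definition D_t :: "real \<Rightarrow> (real \<Rightarrow> real \<Rightarrow> real) \<Rightarrow> real \<Rightarrow> real \<Rightarrow> real" where
  "D_t T f t y = vector_derivative (\<lambda>s. f s y) (at t within {0..<T})"

definition D_y :: "(real \<Rightarrow> real \<Rightarrow> real) \<Rightarrow> real \<Rightarrow> real \<Rightarrow> real" where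
  "D_y f t y = deriv (\<lambda>z. f t z) y"

definition V_t :: "real \<Rightarrow> (real \<Rightarrow> real \<Rightarrow> real \<Rightarrow> real) \<Rightarrow> real \<Rightarrow> real \<Rightarrow> real \<Rightarrow> real" where
  "V_t T V t x y = vector_derivative (\<lambda>s. V s x y) (at t within {0..<T})"

definition V_x :: "(real \<Rightarrow> real \<Rightarrow> real \<Rightarrow> real) \<Rightarrow> real \<Rightarrow> real \<Rightarrow> real \<Rightarrow> real" where
  "V_x V t x y = deriv (\<lambda>z. V t z y) x"

definition V_y :: "(real \<Rightarrow> real \<Rightarrow> real \<Rightarrow> real) \<Rightarrow> real \<Rightarrow> real \<Rightarrow> real \<Rightarrow> real" where
  "V_y V t x y = deriv (\<lambda>z. V t x z) y"

text \<open>\<open>C\<^sup>1\<^sup>,\<^sup>2([0,T) \<times> \<real>) \<inter> C([0,T] \<times> \<real>)\<close>.\<close>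

definition C12 :: "real \<Rightarrow> (real \<Rightarrow> real \<Rightarrow> real) \<Rightarrow> bool" where
  "C12 T f \<longleftrightarrow>
     continuous_on ({0..T} \<times> UNIV) (\<lambda>(t, y). f t y) \<and>
     (\<forall>t\<in>{0..<T}. \<forall>y.
        (\<lambda>s. f s y) differentiable (at t within {0..<T}) \<and>
        (\<lambda>z. f t z) differentiable (at y) \<and>
        (\<lambda>z. D_y f t z) differentiable (at y)) \<and>
     (\<forall>g\<in>{D_t T f, D_y f, D_y (D_y f)}.
        continuous_on ({0..<T} \<times> UNIV) (\<lambda>(t, y). g t y))"

text \<open>\<open>C\<^sup>1\<^sup>,\<^sup>2([0,T) \<times> \<real>\<^sup>2) \<inter> C([0,T] \<times> \<real>\<^sup>2)\<close>.\<close>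

definition C12_2 :: "real \<Rightarrow> (real \<Rightarrow> real \<Rightarrow> real \<Rightarrow> real) \<Rightarrow> bool" where
  "C12_2 T V \<longleftrightarrow>
     continuous_on ({0..T} \<times> UNIV \<times> UNIV) (\<lambda>(t, x, y). V t x y) \<and>
     (\<forall>t\<in>{0..<T}. \<forall>x y.
        (\<lambda>s. V s x y) differentiable (at t within {0..<T}) \<and>
        (\<forall>W\<in>{V, V_x V, V_y V}.
           (\<lambda>z. W t z y) differentiable (at x) \<and>
           (\<lambda>z. W t x z) differentiable (at y))) \<and>
     (\<forall>W\<in>{V_t T V, V_x V, V_y V, V_x (V_x V), V_y (V_x V), V_x (V_y V), V_y (V_y V)}.
        continuous_on ({0..<T} \<times> UNIV \<times> UNIV) (\<lambda>(t, x, y). W t x y))"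

definition f_solution ::
  "real \<Rightarrow> real \<Rightarrow> real \<Rightarrow> real \<Rightarrow> real \<Rightarrow> (real \<Rightarrow> real \<Rightarrow> real) \<Rightarrow> bool" where
  "f_solution T \<sigma> \<sigma>0 a r f \<longleftrightarrow>
     (\<forall>t\<in>{0..<T}. \<forall>y.
        D_t T f t y
        + 1/2 * D_y (D_y f) t y * ((gam \<sigma> \<sigma>0 t)\<^sup>2 / \<sigma>\<^sup>2)
        + D_y f t y * (gam \<sigma> \<sigma>0 t * (r - y) / \<sigma>\<^sup>2)
        - ((r - y + a * sqrt (gam \<sigma> \<sigma>0 t))\<^sup>2 / (2 * \<sigma>\<^sup>2)
             * of_bool (r - y + a * sqrt (gam \<sigma> \<sigma>0 t) \<le> 0)
           + (r - y - a * sqrt (gam \<sigma> \<sigma>0 t))\<^sup>2 / (2 * \<sigma>\<^sup>2)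
             * of_bool (r - y - a * sqrt (gam \<sigma> \<sigma>0 t) \<ge> 0)) = 0) \<and>
     (\<forall>y. f T y = 0)"

definition mu_term ::
  "real \<Rightarrow> real \<Rightarrow> (real \<Rightarrow> real \<Rightarrow> real \<Rightarrow> real) \<Rightarrow> real \<Rightarrow> real \<Rightarrow> real \<Rightarrow> real \<Rightarrow> real \<Rightarrow> real" where
  "mu_term \<sigma> \<sigma>0 V t x y \<pi> \<mu> = \<mu> * (V_x V t x y * \<pi> + V_y V t x y * (gam \<sigma> \<sigma>0 t / \<sigma>\<^sup>2))"

definition HJBI_expr ::
  "real \<Rightarrow> real \<Rightarrow> real \<Rightarrow> real \<Rightarrow> real \<Rightarrow> (real \<Rightarrow> real \<Rightarrow> real \<Rightarrow> real)
    \<Rightarrow> real \<Rightarrow> real \<Rightarrow> real \<Rightarrow> real \<Rightarrow> real" where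
  "HJBI_expr T \<sigma> \<sigma>0 a r V t x y \<pi> =
     V_t T V t x y
     + 1/2 * V_x (V_x V) t x y * \<pi>\<^sup>2 * \<sigma>\<^sup>2
     + 1/2 * V_y (V_y V) t x y * ((gam \<sigma> \<sigma>0 t)\<^sup>2 / \<sigma>\<^sup>2)
     + V_y (V_x V) t x y * \<pi> * gam \<sigma> \<sigma>0 t
     + V_x V t x y * r * (x - \<pi>)
     - V_y V t x y * (gam \<sigma> \<sigma>0 t / \<sigma>\<^sup>2) * y
     + (INF \<mu>\<in>Lam \<sigma> \<sigma>0 a t y. mu_term \<sigma> \<sigma>0 V t x y \<pi> \<mu>)"

text \<open>
  Classical solutions. The supremum over all \<open>\<pi>\<close> is taken in the extended reals, since the real
  supremum of an unbounded set is unspecified. The infimum in \<open>HJBI_expr\<close> is that of a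
  continuous function on a compact interval, which is nonempty for \<open>a \<ge> 0\<close>.
\<close>

definition HJBI_solution ::
  "real \<Rightarrow> real \<Rightarrow> real \<Rightarrow> real \<Rightarrow> real \<Rightarrow> real \<Rightarrow> (real \<Rightarrow> real \<Rightarrow> real \<Rightarrow> real) \<Rightarrow> bool" where
  "HJBI_solution T \<sigma> \<sigma>0 k a r V \<longleftrightarrow>
     C12_2 T V \<and>
     (\<forall>t\<in>{0..<T}. \<forall>x y. (SUP \<pi>. ereal (HJBI_expr T \<sigma> \<sigma>0 a r V t x y \<pi>)) = 0) \<and>
     (\<forall>x y. V T x y = U k x)"

definition phi ::
  "real \<Rightarrow> real \<Rightarrow> real \<Rightarrow> (real \<Rightarrow> real \<Rightarrow> real) \<Rightarrow> real \<Rightarrow> real \<Rightarrow> real \<Rightarrow> real" where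
  "phi T k r f t x y = - (1 / k) * exp (- k * exp (r * (T - t)) * x + f t y)"

definition pi_hat ::
  "real \<Rightarrow> real \<Rightarrow> real \<Rightarrow> real \<Rightarrow> real \<Rightarrow> real \<Rightarrow> (real \<Rightarrow> real \<Rightarrow> real) \<Rightarrow> real \<Rightarrow> real \<Rightarrow> real" where
  "pi_hat T \<sigma> \<sigma>0 k a r f t y =
     (if r < mu_min \<sigma> \<sigma>0 a t y then
        exp (- r * (T - t)) / (k * \<sigma>\<^sup>2)
          * (D_y f t y * gam \<sigma> \<sigma>0 t + y - a * sqrt (gam \<sigma> \<sigma>0 t) - r)
      else if r > mu_max \<sigma> \<sigma>0 a t y then
        exp (- r * (T - t)) / (k * \<sigma>\<^sup>2)
          * (D_y f t y * gam \<sigma> \<sigma>0 t + y + a * sqrt (gam \<sigma> \<sigma>0 t) - r)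
      else
        exp (- r * (T - t)) / (k * \<sigma>\<^sup>2) * (D_y f t y * gam \<sigma> \<sigma>0 t))"

text \<open>The set of admissible choices of \<open>\<mu>\<^sup>*\<close>.\<close>

definition mu_star :: "real \<Rightarrow> real \<Rightarrow> real \<Rightarrow> real \<Rightarrow> real \<Rightarrow> real \<Rightarrow> real set" where
  "mu_star \<sigma> \<sigma>0 a r t y =
     (if r < mu_min \<sigma> \<sigma>0 a t y then {mu_min \<sigma> \<sigma>0 a t y}
      else if r > mu_max \<sigma> \<sigma>0 a t y then {mu_max \<sigma> \<sigma>0 a t y}
      else Lam \<sigma> \<sigma>0 a t y)"

end

theory Submission
  imports Defs
begin

text \<open>
  Divide the HJBI expression by \<open>\<phi> < 0\<close> and substitute
  \<open>d = k e\<^sup>r\<^sup>(\<^sup>T\<^sup>-\<^sup>t\<^sup>) \<pi> - f\<^sub>y \<gamma> / \<sigma>\<^sup>2\<close>. The infimum over \<open>\<mu>\<close> contributes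
  \<open>a \<surd>\<gamma> \<bar>d\<bar>\<close>, and all that depends on \<open>\<pi>\<close> is \<open>\<sigma>\<^sup>2 d\<^sup>2 / 2 + (r - y) d + a \<surd>\<gamma> \<bar>d\<bar>\<close>. The minimum of
  this convex function of \<open>d\<close> is minus the bracket with indicators in the equation for \<open>f\<close>, so that
  equation says exactly that the supremum over \<open>\<pi>\<close> is \<open>0\<close>.
\<close>

section \<open>Linear functions on a centered interval\<close>

text \<open>A linear function is smallest at an end point: the left one for
  \<open>c \<ge> 0\<close>, the right one for \<open>c < 0\<close>. Both cases combine into the term
  \<open>s * \<bar>c\<bar>\<close>, which is the price of ambiguity.\<close>

lemma INF_mult_centered_interval:
  fixes y s c :: real
  assumes "s \<ge> 0"
  shows "(INF \<mu>\<in>{y - s..y + s}. \<mu> * c) = y * c - s * \<bar>c\<bar>"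
proof (rule cInf_eq_minimum)
  have "y * c - s * \<bar>c\<bar> = (if c \<ge> 0 then y - s else y + s) * c"
    by (simp add: algebra_simps)
  then show "y * c - s * \<bar>c\<bar> \<in> (\<lambda>\<mu>. \<mu> * c) ` {y - s..y + s}"
    using assms by auto
next
  fix v assume "v \<in> (\<lambda>\<mu>. \<mu> * c) ` {y - s..y + s}"
  then obtain \<mu> where \<mu>: "v = \<mu> * c" "\<mu> \<in> {y - s..y + s}" by blast
  have "(y - \<mu>) * c \<le> \<bar>y - \<mu>\<bar> * \<bar>c\<bar>" by (metis abs_ge_self abs_mult)
  also have "\<dots> \<le> s * \<bar>c\<bar>" using \<mu>(2) by (intro mult_right_mono) (auto simp: abs_le_iff)
  finally show "y * c - s * \<bar>c\<bar> \<le> v" using \<mu> by (simp add: algebra_simps)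
qed

text \<open>For \<open>c \<noteq> 0\<close> the factor \<open>c\<close> cancels and leaves a single
  end point; for \<open>c = 0\<close> the function is constant, which is the source of "any \<mu>"
  in the worst-case scenario.\<close>

lemma argmin_mult_centered_interval:
  fixes y s c :: real
  assumes "s \<ge> 0"
  shows "{\<mu>\<in>{y - s..y + s}. \<mu> * c = (INF \<nu>\<in>{y - s..y + s}. \<nu> * c)} =
    (if c > 0 then {y - s} else if c < 0 then {y + s} else {y - s..y + s})"
proof (cases "c = 0")
  case True
  then show ?thesis unfolding INF_mult_centered_interval[OF assms] by auto
next
  case False
  have "y * c - s * \<bar>c\<bar> = (if c > 0 then y - s else y + s) * c"
    by (simp add: algebra_simps)
  then have "\<mu> * c = y * c - s * \<bar>c\<bar> \<longleftrightarrow> \<mu> = (if c > 0 then y - s else y + s)" for \<mu>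
    using False by (simp only: mult_cancel_right simp_thms)
  then show ?thesis
    unfolding INF_mult_centered_interval[OF assms] using False assms by auto
qed

section \<open>A quadratic with an absolute-value penalty\<close>

text \<open>For \<open>s \<ge> 0\<close> this is the squared distance from \<rho> to the interval
  from \<open>-s\<close> to \<open>s\<close>, divided by \<open>2 * \<sigma>\<^sup>2\<close>. As a
  function of \<rho> it is the convex conjugate of
  \<open>\<sigma>\<^sup>2 * d\<^sup>2 / 2 + s * \<bar>d\<bar>\<close>.\<close>

definition dual_penalty :: "real \<Rightarrow> real \<Rightarrow> real \<Rightarrow> real" where
  "dual_penalty \<sigma> s \<rho> =
     (\<rho> + s)\<^sup>2 / (2 * \<sigma>\<^sup>2) * of_bool (\<rho> + s \<le> 0) + (\<rho> - s)\<^sup>2 / (2 * \<sigma>\<^sup>2) * of_bool (\<rho> - s \<ge> 0)"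

text \<open>The soft-thresholding operator at \<open>-\<rho>\<close> with threshold
  \<open>s\<close>, scaled by \<open>1 / \<sigma>\<^sup>2\<close>: the minimizer \<open>d\<close> of
  \<open>\<sigma>\<^sup>2 * d\<^sup>2 / 2 + \<rho> * d + s * \<bar>d\<bar>\<close>.\<close>

definition soft_threshold :: "real \<Rightarrow> real \<Rightarrow> real \<Rightarrow> real" where
  "soft_threshold \<sigma> s \<rho> =
     (if \<rho> + s < 0 then - (\<rho> + s) / \<sigma>\<^sup>2 else if \<rho> - s > 0 then - (\<rho> - s) / \<sigma>\<^sup>2 else 0)"

text \<open>Outside the threshold, bound \<open>s * \<bar>d\<bar>\<close> below by
  \<open>s * d\<close> or \<open>- s * d\<close>, whichever makes the penalty complete the square.
  Inside it, \<open>\<bar>\<rho>\<bar> \<le> s\<close>, so the absolute value dominates the linear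
  term.\<close>

lemma penalized_quadratic_nonneg:
  assumes "\<sigma> > 0" "s \<ge> 0"
  shows "\<sigma>\<^sup>2 * d\<^sup>2 / 2 + \<rho> * d + s * \<bar>d\<bar> + dual_penalty \<sigma> s \<rho> \<ge> 0"
proof -
  have square: "\<sigma>\<^sup>2 * d\<^sup>2 / 2 + u * d + u\<^sup>2 / (2 * \<sigma>\<^sup>2) = (\<sigma>\<^sup>2 * d + u)\<^sup>2 / (2 * \<sigma>\<^sup>2)" for u
    using assms by (simp add: field_simps power2_eq_square)
  have square_nonneg: "\<sigma>\<^sup>2 * d\<^sup>2 / 2 + u * d + u\<^sup>2 / (2 * \<sigma>\<^sup>2) \<ge> 0" for u
    unfolding square by simp
  have s_abs: "- (s * d) \<le> s * \<bar>d\<bar>" "s * d \<le> s * \<bar>d\<bar>"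
    using mult_left_mono[OF abs_ge_self[of d] assms(2)] mult_left_mono[OF abs_ge_minus_self[of d] assms(2)]
    by auto
  consider "\<rho> + s < 0" | "\<rho> - s > 0" | "\<rho> + s \<ge> 0" "\<rho> - s \<le> 0" by linarith
  then show ?thesis
  proof cases
    case 1
    then show ?thesis
      using square_nonneg[of "\<rho> + s"] s_abs assms(2)
      by (simp add: dual_penalty_def algebra_simps)
  next
    case 2
    then show ?thesis
      using square_nonneg[of "\<rho> - s"] s_abs assms(2)
      by (simp add: dual_penalty_def algebra_simps)
  next
    case 3
    then have "\<bar>\<rho>\<bar> * \<bar>d\<bar> \<le> s * \<bar>d\<bar>" by (intro mult_right_mono) auto
    moreover have "- (\<rho> * d) \<le> \<bar>\<rho>\<bar> * \<bar>d\<bar>" by (metis abs_ge_minus_self abs_mult)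
    moreover have "dual_penalty \<sigma> s \<rho> \<ge> 0" "\<sigma>\<^sup>2 * d\<^sup>2 / 2 \<ge> 0" by (auto simp: dual_penalty_def)
    ultimately show ?thesis by linarith
  qed
qed

text \<open>In each branch the sign of \<open>d\<close> makes the bound
  \<open>s * \<bar>d\<bar> \<ge> s * d\<close> or \<open>s * \<bar>d\<bar> \<ge> - s * d\<close> an
  equality, and \<open>d\<close> is the vertex of the completed square.\<close>

lemma penalized_quadratic_soft_threshold:
  fixes \<sigma> s \<rho> :: real
  assumes "\<sigma> > 0" "s \<ge> 0"
  defines "d \<equiv> soft_threshold \<sigma> s \<rho>"
  shows "\<sigma>\<^sup>2 * d\<^sup>2 / 2 + \<rho> * d + s * \<bar>d\<bar> + dual_penalty \<sigma> s \<rho> = 0"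
proof -
  have square: "\<sigma>\<^sup>2 * (- u / \<sigma>\<^sup>2)\<^sup>2 / 2 + u * (- u / \<sigma>\<^sup>2) + u\<^sup>2 / (2 * \<sigma>\<^sup>2) = 0" for u
    using assms by (simp add: field_simps power2_eq_square)
  consider "\<rho> + s < 0" | "\<rho> - s > 0" | "\<rho> + s \<ge> 0" "\<rho> - s \<le> 0" by linarith
  then show ?thesis
  proof cases
    case 1
    then have d: "d = - (\<rho> + s) / \<sigma>\<^sup>2" by (simp add: d_def soft_threshold_def)
    with 1 have "d \<ge> 0" by (simp add: zero_le_divide_iff)
    then have "\<rho> * d + s * \<bar>d\<bar> = (\<rho> + s) * d" by (simp add: algebra_simps)
    moreover have "dual_penalty \<sigma> s \<rho> = (\<rho> + s)\<^sup>2 / (2 * \<sigma>\<^sup>2)"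
      using 1 assms(2) by (simp add: dual_penalty_def)
    ultimately show ?thesis using square[of "\<rho> + s"] by (simp only: d)
  next
    case 2
    then have d: "d = - (\<rho> - s) / \<sigma>\<^sup>2" using assms(2) by (simp add: d_def soft_threshold_def)
    with 2 have "d \<le> 0" by (simp add: divide_le_0_iff)
    then have "\<rho> * d + s * \<bar>d\<bar> = (\<rho> - s) * d" by (simp add: algebra_simps)
    moreover have "dual_penalty \<sigma> s \<rho> = (\<rho> - s)\<^sup>2 / (2 * \<sigma>\<^sup>2)"
      using 2 assms(2) by (simp add: dual_penalty_def)
    ultimately show ?thesis using square[of "\<rho> - s"] by (simp only: d)
  next
    case 3
    then have "d = 0" by (simp add: d_def soft_threshold_def)
    moreover have "dual_penalty \<sigma> s \<rho> = 0" using 3 by (auto simp: dual_penalty_def)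
    ultimately show ?thesis by simp
  qed
qed

section \<open>Signs, and the partial derivatives of \<open>phi\<close>\<close>

lemma gam_nonneg: "t \<ge> 0 \<Longrightarrow> gam \<sigma> \<sigma>0 t \<ge> 0"
  by (simp add: gam_def)

lemma phi_neg: "k > 0 \<Longrightarrow> phi T k r f t x y < 0"
  by (simp add: phi_def)

lemma C12_has_derivatives:
  assumes "C12 T f" "t \<in> {0..<T}"
  shows "((\<lambda>s. f s y) has_real_derivative D_t T f t y) (at t within {0..<T})"
    and "(f t has_real_derivative D_y f t y) (at y)"
    and "(D_y f t has_real_derivative D_y (D_y f) t y) (at y)"
proof -
  have "(\<lambda>s. f s y) differentiable (at t within {0..<T})"
    "(\<lambda>z. f t z) differentiable (at y)" "(\<lambda>z. D_y f t z) differentiable (at y)"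
    using assms unfolding C12_def by auto
  then show "((\<lambda>s. f s y) has_real_derivative D_t T f t y) (at t within {0..<T})"
    "(f t has_real_derivative D_y f t y) (at y)"
    "(D_y f t has_real_derivative D_y (D_y f) t y) (at y)"
    unfolding D_t_def D_y_def[of f t y] D_y_def[of "D_y f" t y]
    by (simp_all add: has_real_derivative_iff_has_vector_derivative[where F = "at t within {0..<T}"]
        vector_derivative_works DERIV_deriv_iff_real_differentiable)
qed

lemma phi_has_derivative_x:
  "((\<lambda>z. phi T k r f t z y) has_real_derivative - k * exp (r * (T - t)) * phi T k r f t x y) (at x)"
  unfolding phi_def
  by (rule DERIV_cong, rule DERIV_cmult, (rule derivative_eq_intros refl)+)
    simp

lemma phi_has_derivative_y:
  assumes "(f t has_real_derivative d) (at y)"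
  shows "((\<lambda>z. phi T k r f t x z) has_real_derivative d * phi T k r f t x y) (at y)"
  unfolding phi_def
  by (rule DERIV_cong, rule DERIV_cmult, (rule derivative_eq_intros assms refl)+) simp

lemma phi_has_derivative_t:
  assumes "((\<lambda>s. f s y) has_real_derivative d) (at t within S)"
  shows "((\<lambda>s. phi T k r f s x y) has_real_derivative
    (k * r * exp (r * (T - t)) * x + d) * phi T k r f t x y) (at t within S)"
  unfolding phi_def
  by (rule DERIV_cong, rule DERIV_cmult, (rule derivative_eq_intros assms refl)+)
    (simp add: algebra_simps add_divide_distrib)

lemma V_x_phi: "V_x (phi T k r f) t x y = - k * exp (r * (T - t)) * phi T k r f t x y"
  unfolding V_x_def by (rule DERIV_imp_deriv[OF phi_has_derivative_x])

text \<open>The formula for \<open>V_x\<close> holds at every time and for every \<open>f\<close>,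
  so it is an equation of functions and can be rewritten under a further derivative. The formulas
  for \<open>V_t\<close> and \<open>V_y\<close> are restricted to times before
  \<open>T\<close>.\<close>

lemma V_x_phi_eq: "V_x (phi T k r f) = (\<lambda>t x y. - k * exp (r * (T - t)) * phi T k r f t x y)"
  by (intro ext V_x_phi)

lemma V_x_V_x_phi: "V_x (V_x (phi T k r f)) t x y = (k * exp (r * (T - t)))\<^sup>2 * phi T k r f t x y"
  unfolding V_x_phi_eq V_x_def[of "\<lambda>t x y. - k * exp (r * (T - t)) * phi T k r f t x y"]
  by (rule DERIV_imp_deriv)
    (auto intro!: derivative_eq_intros phi_has_derivative_x simp: power2_eq_square)

context
  fixes T k r t :: real and f :: "real \<Rightarrow> real \<Rightarrow> real"
  assumes C12: "C12 T f" and t: "t \<in> {0..<T}"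
begin

lemmas f_derivatives = C12_has_derivatives[OF C12 t]
lemmas phi_derivative_y = phi_has_derivative_y[where f = f and t = t, OF f_derivatives(2)]

lemma V_t_phi:
  "V_t T (phi T k r f) t x y =
    (k * r * exp (r * (T - t)) * x + D_t T f t y) * phi T k r f t x y"
proof -
  \<comment> \<open>A derivative within a set is unique only at a limit point of that set; this
    covers the right derivative at time 0.\<close>
  have "at t within {0..<T} \<noteq> bot"
    using t by (simp add: trivial_limit_within islimpt_Ico)
  then show ?thesis
    unfolding V_t_def
    using phi_has_derivative_t[where f = f and y = y, OF f_derivatives(1)]
    by (intro vector_derivative_within)
      (auto simp: has_real_derivative_iff_has_vector_derivative)
qed

lemma V_y_phi: "V_y (phi T k r f) t x y = D_y f t y * phi T k r f t x y"
  unfolding V_y_def by (rule DERIV_imp_deriv[OF phi_derivative_y])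

lemma V_x_phi_has_derivative_y:
  "((\<lambda>z. V_x (phi T k r f) t x z) has_real_derivative
    - k * exp (r * (T - t)) * D_y f t y * phi T k r f t x y) (at y)"
  unfolding V_x_phi by (auto intro!: derivative_eq_intros phi_derivative_y)

lemma V_y_phi_has_derivative_x:
  "((\<lambda>z. V_y (phi T k r f) t z y) has_real_derivative
    - k * exp (r * (T - t)) * D_y f t y * phi T k r f t x y) (at x)"
  unfolding V_y_phi by (auto intro!: derivative_eq_intros phi_has_derivative_x)

lemma V_y_phi_has_derivative_y:
  "((\<lambda>z. V_y (phi T k r f) t x z) has_real_derivative
    (D_y (D_y f) t y + (D_y f t y)\<^sup>2) * phi T k r f t x y) (at y)"
  unfolding V_y_phi
  by (auto intro!: derivative_eq_intros phi_derivative_y f_derivatives(3)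
      simp: algebra_simps power2_eq_square)

lemma V_y_V_x_phi:
  "V_y (V_x (phi T k r f)) t x y = - k * exp (r * (T - t)) * D_y f t y * phi T k r f t x y"
  unfolding V_y_def by (rule DERIV_imp_deriv[OF V_x_phi_has_derivative_y])

text \<open>The class \<open>C12_2\<close> asks for both orders of mixed differentiation, whereas
  the equation is written with \<open>V_y (V_x V)\<close>.\<close>

lemma V_x_V_y_phi:
  "V_x (V_y (phi T k r f)) t x y = - k * exp (r * (T - t)) * D_y f t y * phi T k r f t x y"
  unfolding V_x_def by (rule DERIV_imp_deriv[OF V_y_phi_has_derivative_x])

lemma V_y_V_y_phi:
  "V_y (V_y (phi T k r f)) t x y = (D_y (D_y f) t y + (D_y f t y)\<^sup>2) * phi T k r f t x y"
  unfolding V_y_def[of "V_y (phi T k r f)"] by (rule DERIV_imp_deriv[OF V_y_phi_has_derivative_y])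

lemma phi_differentiable:
  shows "(\<lambda>s. phi T k r f s x y) differentiable (at t within {0..<T})"
    and "W \<in> {phi T k r f, V_x (phi T k r f), V_y (phi T k r f)} \<Longrightarrow>
      (\<lambda>z. W t z y) differentiable (at x) \<and> (\<lambda>z. W t x z) differentiable (at y)"
proof -
  have diff: "g differentiable F" if "(g has_real_derivative D) F" for g D F
    using that by (auto simp: real_differentiable_def has_field_derivative_def differentiable_def)
  show "(\<lambda>s. phi T k r f s x y) differentiable (at t within {0..<T})"
    by (rule diff, rule phi_has_derivative_t, rule f_derivatives(1))
  have "(\<lambda>z. phi T k r f t z y) differentiable (at x)"
    by (rule diff, rule phi_has_derivative_x)
  moreover have "(\<lambda>z. phi T k r f t x z) differentiable (at y)"
    by (rule diff, rule phi_derivative_y)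
  moreover have "(\<lambda>z. V_x (phi T k r f) t z y) differentiable (at x)"
    unfolding V_x_phi by (rule diff, rule DERIV_cmult, rule phi_has_derivative_x)
  moreover have "(\<lambda>z. V_x (phi T k r f) t x z) differentiable (at y)"
    by (rule diff, rule V_x_phi_has_derivative_y)
  moreover have "(\<lambda>z. V_y (phi T k r f) t z y) differentiable (at x)"
    by (rule diff, rule V_y_phi_has_derivative_x)
  moreover have "(\<lambda>z. V_y (phi T k r f) t x z) differentiable (at y)"
    by (rule diff, rule V_y_phi_has_derivative_y)
  ultimately show "W \<in> {phi T k r f, V_x (phi T k r f), V_y (phi T k r f)} \<Longrightarrow>
      (\<lambda>z. W t z y) differentiable (at x) \<and> (\<lambda>z. W t x z) differentiable (at y)"
    by blast
qed

end

section \<open>Regularity of \<open>phi\<close>\<close>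

lemma continuous_on_add_middle_variable:
  assumes "continuous_on (S \<times> UNIV) (\<lambda>(t, y). g t y)"
  shows "continuous_on (S \<times> UNIV \<times> UNIV) (\<lambda>(t, x, y). g t y)"
proof -
  have "continuous_on (S \<times> UNIV \<times> UNIV) (\<lambda>p. (\<lambda>(t, y). g t y) (fst p, snd (snd p)))"
    by (rule continuous_on_compose2[OF assms]) (auto intro!: continuous_intros)
  then show ?thesis by (simp add: case_prod_unfold)
qed

lemma continuous_on_phi:
  assumes "continuous_on (S \<times> UNIV) (\<lambda>(t, y). f t y)"
  shows "continuous_on (S \<times> UNIV \<times> UNIV) (\<lambda>(t, x, y). phi T k r f t x y)"
  using continuous_on_add_middle_variable[OF assms]
  unfolding phi_def case_prod_unfold
  by (intro continuous_on_mult_left) (auto intro!: continuous_intros)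

text \<open>Every derivative of \<open>phi\<close> is \<open>phi\<close> times a polynomial in
  \<open>x\<close>, an exponential in time and the derivatives of \<open>f\<close>, so continuity is
  inherited from \<open>C12 T f\<close>.\<close>

lemma C12_2_phi:
  assumes "C12 T f"
  shows "C12_2 T (phi T k r f)"
proof -
  let ?S = "{0..<T} \<times> (UNIV :: real set) \<times> (UNIV :: real set)"
  let ?V = "phi T k r f"
  have cont: "continuous_on ({0..T} \<times> UNIV) (\<lambda>(t, y). f t y)"
    using assms by (simp add: C12_def)
  have cont_phi: "continuous_on ?S (\<lambda>(t, x, y). ?V t x y)"
    by (rule continuous_on_subset[OF continuous_on_phi[OF cont]]) auto
  have cont_f: "continuous_on ?S (\<lambda>(t, x, y). g t y)" if "g \<in> {D_t T f, D_y f, D_y (D_y f)}" for g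
    using assms that unfolding C12_def by (intro continuous_on_add_middle_variable) blast
  have conts: "continuous_on ?S (\<lambda>p. ?V (fst p) (fst (snd p)) (snd (snd p)))"
    "continuous_on ?S (\<lambda>p. D_t T f (fst p) (snd (snd p)))"
    "continuous_on ?S (\<lambda>p. D_y f (fst p) (snd (snd p)))"
    "continuous_on ?S (\<lambda>p. D_y (D_y f) (fst p) (snd (snd p)))"
    using cont_phi cont_f[of "D_t T f"] cont_f[of "D_y f"] cont_f[of "D_y (D_y f)"]
    by (simp_all add: case_prod_unfold)
  \<comment> \<open>The closed forms may fail at times outside \<open>{0..<T}\<close>, so continuity
    is transferred along equality on \<open>?S\<close> instead of by rewriting the
    functions.\<close>
  have formula: "continuous_on ?S (\<lambda>(t, x, y). W t x y)"
    if "\<And>t x y. t \<in> {0..<T} \<Longrightarrow> W t x y = G t x y"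
      and "continuous_on ?S (\<lambda>p. G (fst p) (fst (snd p)) (snd (snd p)))" for W G
    by (rule continuous_on_eq[OF that(2)]) (auto simp: that(1))
  have "continuous_on ?S (\<lambda>(t, x, y). V_t T ?V t x y)"
    by (rule formula, erule V_t_phi[OF assms]) (intro continuous_intros conts)
  moreover have "continuous_on ?S (\<lambda>(t, x, y). V_x ?V t x y)"
    by (rule formula, rule V_x_phi) (intro continuous_intros conts)
  moreover have "continuous_on ?S (\<lambda>(t, x, y). V_y ?V t x y)"
    by (rule formula, erule V_y_phi[OF assms]) (intro continuous_intros conts)
  moreover have "continuous_on ?S (\<lambda>(t, x, y). V_x (V_x ?V) t x y)"
    by (rule formula, rule V_x_V_x_phi) (intro continuous_intros conts)
  moreover have "continuous_on ?S (\<lambda>(t, x, y). V_y (V_x ?V) t x y)"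
    by (rule formula, erule V_y_V_x_phi[OF assms]) (intro continuous_intros conts)
  moreover have "continuous_on ?S (\<lambda>(t, x, y). V_x (V_y ?V) t x y)"
    by (rule formula, erule V_x_V_y_phi[OF assms]) (intro continuous_intros conts)
  moreover have "continuous_on ?S (\<lambda>(t, x, y). V_y (V_y ?V) t x y)"
    by (rule formula, erule V_y_V_y_phi[OF assms]) (intro continuous_intros conts)
  ultimately show ?thesis
    unfolding C12_2_def
    using continuous_on_phi[OF cont] phi_differentiable[OF assms]
    by blast
qed

section \<open>The HJBI expression in the shifted control\<close>

definition excess :: "real \<Rightarrow> real \<Rightarrow> real \<Rightarrow> real \<Rightarrow> real \<Rightarrow> (real \<Rightarrow> real \<Rightarrow> real) \<Rightarrow> real \<Rightarrow> real \<Rightarrow> real \<Rightarrow> real"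
  where "excess T \<sigma> \<sigma>0 k r f t y \<pi> =
    k * exp (r * (T - t)) * \<pi> - D_y f t y * (gam \<sigma> \<sigma>0 t / \<sigma>\<^sup>2)"

text \<open>Solving \<open>excess = soft_threshold\<close> for \<pi> gives \<open>pi_hat\<close>:
  with \<open>\<rho> = r - y\<close>, the cases \<open>r < mu_min\<close> and
  \<open>r > mu_max\<close> are \<open>\<rho> + s < 0\<close> and
  \<open>\<rho> - s > 0\<close>.\<close>

lemma excess_pi_hat:
  assumes "k \<noteq> 0"
  shows "excess T \<sigma> \<sigma>0 k r f t y (pi_hat T \<sigma> \<sigma>0 k a r f t y) =
    soft_threshold \<sigma> (a * sqrt (gam \<sigma> \<sigma>0 t)) (r - y)"
proof -
  have cancel: "k * exp (r * (T - t)) * (exp (- r * (T - t)) / (k * \<sigma>\<^sup>2) * c) = c / \<sigma>\<^sup>2" for c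
    using assms by (simp add: field_simps flip: exp_add)
  show ?thesis
    unfolding excess_def pi_hat_def soft_threshold_def mu_min_def mu_max_def
    by (simp only: cancel if_distrib[of "\<lambda>u. k * exp (r * (T - t)) * u"])
      (auto simp: diff_divide_distrib add_divide_distrib)
qed

lemma mu_term_phi:
  assumes "C12 T f" "t \<in> {0..<T}"
  shows "mu_term \<sigma> \<sigma>0 (phi T k r f) t x y \<pi> \<mu> =
    \<mu> * (- phi T k r f t x y * excess T \<sigma> \<sigma>0 k r f t y \<pi>)"
  unfolding mu_term_def V_x_phi V_y_phi[OF assms] excess_def by (simp add: algebra_simps)

text \<open>After division by \<open>phi\<close>, the second-order terms in \<pi> and
  \<open>D_y f\<close> form the square of \<open>d\<close>, the first-order terms split along
  \<open>k * \<beta> * \<pi> = d + g\<close>, and what is free of \<open>d\<close> is the left part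
  of the equation for \<open>f\<close>, hence the penalty.\<close>

lemma HJBI_expr_phi:
  fixes y :: real
  assumes "\<sigma> > 0" "k > 0" "a \<ge> 0" "C12 T f" "f_solution T \<sigma> \<sigma>0 a r f" "t \<in> {0..<T}"
  defines "s \<equiv> a * sqrt (gam \<sigma> \<sigma>0 t)" and "d \<equiv> excess T \<sigma> \<sigma>0 k r f t y"
  shows "HJBI_expr T \<sigma> \<sigma>0 a r (phi T k r f) t x y \<pi> = phi T k r f t x y *
    (\<sigma>\<^sup>2 * (d \<pi>)\<^sup>2 / 2 + (r - y) * d \<pi> + s * \<bar>d \<pi>\<bar> + dual_penalty \<sigma> s (r - y))"
proof -
  define V \<beta> \<gamma> where "V = phi T k r f t x y" and "\<beta> = exp (r * (T - t))" and "\<gamma> = gam \<sigma> \<sigma>0 t"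
  define g where "g = D_y f t y * (\<gamma> / \<sigma>\<^sup>2)"
  have "s \<ge> 0" using assms gam_nonneg[of t \<sigma> \<sigma>0] by simp
  have "V < 0" unfolding V_def using phi_neg \<open>k > 0\<close> .
  have d: "d \<pi> = k * \<beta> * \<pi> - g" by (simp add: d_def excess_def \<beta>_def g_def \<gamma>_def)
  have inf: "(INF \<mu>\<in>Lam \<sigma> \<sigma>0 a t y. mu_term \<sigma> \<sigma>0 (phi T k r f) t x y \<pi> \<mu>) =
      V * (s * \<bar>d \<pi>\<bar> - y * d \<pi>)"
    \<comment> \<open>Since \<open>V < 0\<close>, the absolute value of the coefficient
      \<open>- V * d \<pi>\<close> is \<open>- V * \<bar>d \<pi>\<bar>\<close>.\<close>
    using INF_mult_centered_interval[OF \<open>s \<ge> 0\<close>, of "- V * d \<pi>" y] \<open>V < 0\<close>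
    unfolding mu_term_phi[OF assms(4,6)] Lam_def mu_min_def mu_max_def
      s_def[symmetric] V_def[symmetric] d_def[symmetric]
    by (simp add: abs_mult algebra_simps)
  have g: "D_y f t y * \<gamma> = g * \<sigma>\<^sup>2" using assms(1) by (simp add: g_def)
  have pde: "D_t T f t y + D_y (D_y f) t y * (\<gamma>\<^sup>2 / \<sigma>\<^sup>2) / 2 + g * (r - y) =
      dual_penalty \<sigma> s (r - y)"
    using assms(5)[unfolded f_solution_def, THEN conjunct1, rule_format, OF assms(6), of y]
    by (simp add: s_def dual_penalty_def g_def \<gamma>_def mult.assoc)
  have "(D_y f t y)\<^sup>2 * (\<gamma>\<^sup>2 / \<sigma>\<^sup>2) = (D_y f t y * \<gamma>)\<^sup>2 / \<sigma>\<^sup>2" by (simp add: power_mult_distrib)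
  also have "\<dots> = g\<^sup>2 * \<sigma>\<^sup>2" unfolding g using assms(1) by (simp add: power2_eq_square)
  finally have gg: "(D_y f t y)\<^sup>2 * (\<gamma>\<^sup>2 / \<sigma>\<^sup>2) = g\<^sup>2 * \<sigma>\<^sup>2" .
  \<comment> \<open>With the absolute value and the quotient hidden behind names, both
    rearrangements below treat them as atoms.\<close>
  define A G where "A = \<bar>d \<pi>\<bar>" and "G = \<gamma>\<^sup>2 / \<sigma>\<^sup>2"
  \<comment> \<open>The wealth \<open>x\<close> survives only in the factor \<open>V\<close>: the
    term with \<open>x\<close> in \<open>V_t\<close> cancels \<open>V_x * r * x\<close>. This is
    what the factor \<open>exp (r * (T - t))\<close> in \<open>phi\<close> is for.\<close>
  have "HJBI_expr T \<sigma> \<sigma>0 a r (phi T k r f) t x y \<pi> =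
      V * (D_t T f t y + (k * \<beta> * \<pi>)\<^sup>2 * \<sigma>\<^sup>2 / 2
        + D_y (D_y f) t y * G / 2 + (D_y f t y)\<^sup>2 * G / 2
        - k * \<beta> * \<pi> * (D_y f t y * \<gamma>) + k * \<beta> * r * \<pi> - g * y
        + (s * A - y * d \<pi>))"
    unfolding HJBI_expr_def inf V_t_phi[OF assms(4,6)] V_x_phi
      V_y_phi[OF assms(4,6)] V_x_V_x_phi V_y_V_x_phi[OF assms(4,6)] V_y_V_y_phi[OF assms(4,6)]
      V_def[symmetric] \<beta>_def[symmetric] \<gamma>_def[symmetric] A_def[symmetric] G_def[symmetric] g_def
    by (simp add: algebra_simps power2_eq_square)
  also have "\<dots> = V * (\<sigma>\<^sup>2 * (d \<pi>)\<^sup>2 / 2 + (r - y) * d \<pi> + s * A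
      + (D_t T f t y + D_y (D_y f) t y * G / 2 + g * (r - y)))"
    unfolding g gg[folded G_def] d
    by (simp add: algebra_simps add_divide_distrib diff_divide_distrib power2_eq_square)
  finally show ?thesis unfolding pde[folded G_def] V_def A_def .
qed

section \<open>Supremum, optimal control and worst-case drift\<close>

theorem proposition3p2:
  fixes T \<sigma> \<sigma>0 k a r :: real and f :: "real \<Rightarrow> real \<Rightarrow> real"
  assumes "T > 0" and "\<sigma> > 0" and "\<sigma>0 > 0" and "k > 0" and "a \<ge> 0"
    and "C12 T f"
    and "f_solution T \<sigma> \<sigma>0 a r f"
  shows "HJBI_solution T \<sigma> \<sigma>0 k a r (phi T k r f) \<and>
    (\<forall>t\<in>{0..<T}. \<forall>x y.
       ereal (HJBI_expr T \<sigma> \<sigma>0 a r (phi T k r f) t x y (pi_hat T \<sigma> \<sigma>0 k a r f t y))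
         = (SUP \<pi>. ereal (HJBI_expr T \<sigma> \<sigma>0 a r (phi T k r f) t x y \<pi>))) \<and>
    (\<forall>t\<in>{0..<T}. \<forall>x y.
       {\<mu> \<in> Lam \<sigma> \<sigma>0 a t y.
          mu_term \<sigma> \<sigma>0 (phi T k r f) t x y (pi_hat T \<sigma> \<sigma>0 k a r f t y) \<mu>
          = (INF \<nu>\<in>Lam \<sigma> \<sigma>0 a t y.
               mu_term \<sigma> \<sigma>0 (phi T k r f) t x y (pi_hat T \<sigma> \<sigma>0 k a r f t y) \<nu>)}
       = mu_star \<sigma> \<sigma>0 a r t y)"
proof (intro conjI ballI allI)
  have "k \<noteq> 0" using \<open>k > 0\<close> by simp
  let ?V = "phi T k r f" and ?\<pi> = "pi_hat T \<sigma> \<sigma>0 k a r f"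
  let ?H = "HJBI_expr T \<sigma> \<sigma>0 a r ?V"
  have s_nonneg: "a * sqrt (gam \<sigma> \<sigma>0 t) \<ge> 0" if "t \<in> {0..<T}" for t
    using that \<open>a \<ge> 0\<close> gam_nonneg[of t \<sigma> \<sigma>0] by simp
  note H = HJBI_expr_phi[OF assms(2,4,5,6,7)]
  have H_le: "?H t x y \<pi> \<le> 0" if "t \<in> {0..<T}" for t x y \<pi>
    unfolding H[OF that]
    by (intro mult_nonpos_nonneg penalized_quadratic_nonneg s_nonneg that \<open>\<sigma> > 0\<close>
        less_imp_le[OF phi_neg] \<open>k > 0\<close>)
  have H_pi_hat: "?H t x y (?\<pi> t y) = 0" if "t \<in> {0..<T}" for t x y
    unfolding H[OF that] excess_pi_hat[OF \<open>k \<noteq> 0\<close>]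
      penalized_quadratic_soft_threshold[OF \<open>\<sigma> > 0\<close> s_nonneg[OF that]] by simp
  \<comment> \<open>Zero is an upper bound and is attained at \<open>pi_hat\<close>.\<close>
  have SUP: "(SUP \<pi>. ereal (?H t x y \<pi>)) = 0" if "t \<in> {0..<T}" for t x y
  proof (rule antisym)
    show "(SUP \<pi>. ereal (?H t x y \<pi>)) \<le> 0" using H_le[OF that] by (auto intro!: SUP_least)
    show "0 \<le> (SUP \<pi>. ereal (?H t x y \<pi>))"
      using H_pi_hat[OF that] by (intro SUP_upper2[of "?\<pi> t y"]) auto
  qed
  show "HJBI_solution T \<sigma> \<sigma>0 k a r ?V"
    unfolding HJBI_solution_def
    \<comment> \<open>At time \<open>T\<close> the discount exponent and \<open>f\<close> both
      vanish, so \<open>phi\<close> reduces to \<open>U\<close>.\<close>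
    using C12_2_phi[OF assms(6)] SUP assms(7) by (auto simp: phi_def U_def f_solution_def)
  fix t x y assume t: "t \<in> {0..<T}"
  show "ereal (?H t x y (?\<pi> t y)) = (SUP \<pi>. ereal (?H t x y \<pi>))"
    using SUP[OF t] H_pi_hat[OF t] by (simp add: zero_ereal_def)
  let ?s = "a * sqrt (gam \<sigma> \<sigma>0 t)"
  \<comment> \<open>The coefficient of \<mu> at the optimal control. As \<open>- ?V\<close> is
    positive, its sign is that of the soft threshold, and it vanishes exactly for \<open>r\<close>
    in \<open>Lam\<close>.\<close>
  define c where "c = - ?V t x y * soft_threshold \<sigma> ?s (r - y)"
  have "soft_threshold \<sigma> ?s (r - y) > 0 \<longleftrightarrow> r < y - ?s"
    "soft_threshold \<sigma> ?s (r - y) < 0 \<longleftrightarrow> r > y + ?s"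
    using s_nonneg[OF t] \<open>\<sigma> > 0\<close>
    by (auto simp: soft_threshold_def zero_less_divide_iff divide_less_0_iff)
  then have "c > 0 \<longleftrightarrow> r < y - ?s" "c < 0 \<longleftrightarrow> r > y + ?s"
    using phi_neg[OF \<open>k > 0\<close>, of T r f t x y]
    by (auto simp: c_def zero_less_mult_iff mult_less_0_iff)
  then show "{\<mu> \<in> Lam \<sigma> \<sigma>0 a t y. mu_term \<sigma> \<sigma>0 ?V t x y (?\<pi> t y) \<mu>
      = (INF \<nu>\<in>Lam \<sigma> \<sigma>0 a t y. mu_term \<sigma> \<sigma>0 ?V t x y (?\<pi> t y) \<nu>)} = mu_star \<sigma> \<sigma>0 a r t y"
    unfolding mu_term_phi[OF assms(6) t] excess_pi_hat[OF \<open>k \<noteq> 0\<close>] c_def[symmetric]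
      Lam_def mu_star_def mu_min_def mu_max_def
    using argmin_mult_centered_interval[OF s_nonneg[OF t], of y c] by simp
qed

end
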